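(* For all $n\geq0$, \[ j_{2n}(231)=\frac{1}{2n+1}\binom{3n}{n}\quad\text{and}\quad j_{2n+1}(231)=\frac{1}{2n+1}\binom{3n+1}{n+1}. \]
   Context: A permutation of a finite set $S$ of positive integers is a word in which each element of $S$ appears exactly once; $\mathfrak{S}_n$ is the set of permutations of $\{1,\dots,n\}$. For a permutation $\pi$ and a letter $x$ of $\pi$, $\rho_\pi(x)$ is the maximal consecutive subword of $\pi$ consisting of the letters immediately to the right of $x$ that are all larger than $x$. $\pi$ is Jacobi if $|\rho_\pi(x)|$ is even for all letters $x$. A permutation $\pi$ avoids a pattern $\sigma$ if no subword of $\pi$ has standardization (relative order) $\sigma$. $j_n(231)$ is the number of $231$-avoiding Jacobi permutations in $\mathfrak{S}_n$. *)

theory Defs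
  imports Complex_Main "HOL-Library.Sublist" "HOL-Combinatorics.Multiset_Permutations"
begin

text \<open>Permutations of a finite set \<open>S\<close> are the words (lists) in \<open>permutations_of_set S\<close>.\<close>

definition rho :: "nat list \<Rightarrow> nat \<Rightarrow> nat list" where
  "rho \<pi> x = takeWhile (\<lambda>y. x < y) (tl (dropWhile (\<lambda>y. y \<noteq> x) \<pi>))"

definition jacobi :: "nat list \<Rightarrow> bool" where
  "jacobi \<pi> \<longleftrightarrow> (\<forall>x\<in>set \<pi>. even (length (rho \<pi> x)))"

definition standardization :: "nat list \<Rightarrow> nat list" where
  "standardization w = map (\<lambda>x. card {y \<in> set w. y \<le> x}) w"

text \<open>The subwords relevant to pattern avoidance are not necessarily consecutive.\<close>

definition avoids :: "nat list \<Rightarrow> nat list \<Rightarrow> bool" where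
  "avoids \<pi> \<sigma> \<longleftrightarrow> (\<forall>w. subseq w \<pi> \<longrightarrow> standardization w \<noteq> \<sigma>)"

definition jacobi_avoiding_count :: "nat \<Rightarrow> nat list \<Rightarrow> nat" where
  "jacobi_avoiding_count n \<sigma> =
     card {\<pi> \<in> permutations_of_set {1..n}. jacobi \<pi> \<and> avoids \<pi> \<sigma>}"

end

theory Submission
  imports Defs
begin

text \<open>
  A 231-avoiding word with first letter \<open>v\<close> has the form \<open>v A B\<close> with \<open>A < v < B\<close>. For the last letter
  \<open>l\<close> of \<open>v A\<close> one has \<open>\<rho>(l) = B\<close>, so in a Jacobi word \<open>B\<close> has even length, and then appending \<open>B\<close>
  does not change any parity in \<open>A\<close>. Hence \<open>v A B\<close> is Jacobi iff \<open>|B|\<close> is even and \<open>A\<close>, \<open>B\<close> are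
  Jacobi. With \<open>E\<close> and \<open>O\<close> the generating functions of the even and odd counts this reads
  \<open>O = E\<^sup>2\<close> and \<open>E = 1 + z E O = 1 + z E\<^sup>3\<close>, and the coefficient of \<open>z\<^sup>n\<close> in \<open>E\<^sup>x\<close> is
  \<open>x / (x + 3 n) * (x + 3 n choose n)\<close>.
\<close>

section \<open>Coefficients of powers of the ternary tree series\<close>

text \<open>
  \<open>ternary_coeff n x\<close> is the coefficient of \<open>z\<^sup>n\<close> in \<open>E\<^sup>x\<close>; the recursion is
  \<open>E\<^bsup>x+1\<^esup> = E\<^sup>x + z E\<^bsup>x+3\<^esup>\<close>.
\<close>

fun ternary_coeff :: "nat \<Rightarrow> nat \<Rightarrow> nat" where
  "ternary_coeff 0 x = 1"
| "ternary_coeff (Suc n) 0 = 0"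
| "ternary_coeff (Suc n) (Suc x) = ternary_coeff (Suc n) x + ternary_coeff n (x + 3)"

text \<open>In terms of series this is \<open>E^x * E^y = E^(x+y)\<close>. For fixed
  \<open>y\<close> both sides obey the recursion of \<open>ternary_coeff\<close> in \<open>n\<close>
  and \<open>x\<close>.\<close>

lemma ternary_coeff_convolution:
  "(\<Sum>k\<le>n. ternary_coeff (n - k) x * ternary_coeff k y) = ternary_coeff n (x + y)"
proof (induction n x rule: ternary_coeff.induct)
  case (1 x)
  show ?case by simp
next
  case (2 n)
  have "ternary_coeff (Suc n - k) 0 * ternary_coeff k y = 0" if "k \<le> n" for k
    using that by (simp add: Suc_diff_le)
  then show ?case by simp
next
  case (3 n x)
  have "(\<Sum>k\<le>Suc n. ternary_coeff (Suc n - k) (Suc x) * ternary_coeff k y)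
    = (\<Sum>k\<le>n. (ternary_coeff (Suc n - k) x + ternary_coeff (n - k) (x + 3)) * ternary_coeff k y)
      + ternary_coeff (Suc n) y"
    by (auto simp: Suc_diff_le intro!: sum.cong)
  also have "\<dots> = (\<Sum>k\<le>Suc n. ternary_coeff (Suc n - k) x * ternary_coeff k y)
      + (\<Sum>k\<le>n. ternary_coeff (n - k) (x + 3) * ternary_coeff k y)"
    by (simp add: sum.distrib algebra_simps)
  also have "\<dots> = ternary_coeff (Suc n) (Suc x + y)"
    using 3 by (simp add: ac_simps)
  finally show ?case .
qed

lemma ternary_coeff_closed_form:
  "(x + 3 * n) * ternary_coeff n x = x * (x + 3 * n choose n)"
proof (induction n x rule: ternary_coeff.induct)
  case (3 n x)
  \<comment> \<open>Both recursive terms lead to the upper index \<open>N\<close>, because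
    \<open>x + 3 * Suc n = (x + 3) + 3 * n\<close>. Absorption and Pascal's rule then reduce
    everything to \<open>C\<close>.\<close>
  define N where "N = x + 3 * n + 3"
  define C where "C = (Suc N choose Suc n)"
  have IH: "N * ternary_coeff (Suc n) x = x * (N choose Suc n)"
    "N * ternary_coeff n (x + 3) = (x + 3) * (N choose n)"
    using 3 by (simp_all add: N_def algebra_simps)
  have lower: "Suc N * (N choose n) = Suc n * C"
    unfolding C_def by (metis Suc_times_binomial_eq mult.commute)
  have "C = (N choose n) + (N choose Suc n)"
    by (simp add: C_def)
  then have upper: "Suc N * (N choose Suc n) + Suc n * C = Suc N * C"
    using lower by (simp add: distrib_left)
  have "N * (Suc N * ternary_coeff (Suc n) (Suc x))
    = Suc N * (N * ternary_coeff (Suc n) x) + Suc N * (N * ternary_coeff n (x + 3))"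
    by (simp add: algebra_simps)
  also have "\<dots> = x * (Suc N * (N choose Suc n)) + (x + 3) * (Suc N * (N choose n))"
    unfolding IH by (simp only: mult.left_commute)
  also have "\<dots> = x * (Suc N * (N choose Suc n) + Suc n * C) + 3 * Suc n * C"
    unfolding lower by (simp add: algebra_simps)
  \<comment> \<open>The choice of \<open>N\<close> gives
    \<open>x * Suc N + 3 * Suc n = N * Suc x\<close>.\<close>
  also have "\<dots> = N * (Suc x * C)"
    unfolding upper by (simp add: N_def algebra_simps)
  finally have "Suc N * ternary_coeff (Suc n) (Suc x) = Suc x * C"
    by (simp add: N_def)
  then show ?case
    by (simp add: N_def C_def algebra_simps)
qed simp_all

section \<open>Avoidance of 231\<close>

lemma standardization_eq_231_iff:
  "standardization w = [2, 3, 1] \<longleftrightarrow> (\<exists>x y z. w = [x, y, z] \<and> z < x \<and> x < y)"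
proof
  assume std: "standardization w = [2, 3, 1]"
  define c where "c = (\<lambda>x. card {y \<in> set w. y \<le> x})"
  \<comment> \<open>The rank \<open>c\<close> is monotone, so a strict inequality of ranks forces
    one of letters.\<close>
  have less: "u < v" if "c u < c v" for u v
  proof (rule ccontr)
    assume "\<not> u < v"
    then have "c v \<le> c u"
      unfolding c_def by (intro card_mono) auto
    with that show False by simp
  qed
  have map: "map c w = [2, 3, 1]"
    using std by (simp add: standardization_def c_def)
  then obtain x y z where w: "w = [x, y, z]"
    by (auto simp: map_eq_Cons_conv)
  with map have "c z < c x" "c x < c y" by simp_all
  with w less show "\<exists>x y z. w = [x, y, z] \<and> z < x \<and> x < y" by blast
next
  assume "\<exists>x y z. w = [x, y, z] \<and> z < x \<and> x < y"
  then obtain x y z where w: "w = [x, y, z]" and less: "z < x" "x < y" by blast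
  have "{u \<in> set w. u \<le> x} = {x, z}" "{u \<in> set w. u \<le> y} = {x, y, z}" "{u \<in> set w. u \<le> z} = {z}"
    using less by (auto simp: w)
  then show "standardization w = [2, 3, 1]"
    using less by (simp add: standardization_def w)
qed

definition avoids_231 :: "nat list \<Rightarrow> bool" where
  "avoids_231 w \<longleftrightarrow> (\<forall>x y z. subseq [x, y, z] w \<longrightarrow> z < x \<longrightarrow> \<not> x < y)"

lemma avoids_231_iff: "avoids w [2, 3, 1] \<longleftrightarrow> avoids_231 w"
  unfolding avoids_def avoids_231_def standardization_eq_231_iff by blast

lemma avoids_231_Cons_iff:
  "avoids_231 (v # w) \<longleftrightarrow>
    avoids_231 w \<and> (\<forall>y z. subseq [y, z] w \<longrightarrow> z < v \<longrightarrow> \<not> v < y)"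
  unfolding avoids_231_def by (auto split: if_splits dest: subseq_Cons')

lemma avoids_231_subseq: "avoids_231 w \<Longrightarrow> subseq u w \<Longrightarrow> avoids_231 u"
  unfolding avoids_231_def using subseq_order.trans by blast

lemma subseq_append_splitE:
  assumes "subseq u (A @ B)"
  obtains p q where "u = p @ q" "subseq p A" "subseq q B" "set p \<subseteq> set A" "set q \<subseteq> set B"
proof -
  obtain p q where "u = p @ q" "subseq p A" "subseq q B"
    using assms[THEN subseq_append_iff[THEN iffD1]] by blast
  then show thesis
    by (intro that) (auto simp: subseq_conv_nths dest: in_set_nthsD)
qed

text \<open>An occurrence of 231 ends with its smallest letter, so it cannot start in
  \<open>A\<close> and end in \<open>B\<close>, where all letters are larger.\<close>

lemma avoids_231_append_iff:
  assumes "\<And>a b. a \<in> set A \<Longrightarrow> b \<in> set B \<Longrightarrow> a < b"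
  shows "avoids_231 (A @ B) \<longleftrightarrow> avoids_231 A \<and> avoids_231 B"
proof safe
  assume "avoids_231 A" "avoids_231 B"
  show "avoids_231 (A @ B)"
    unfolding avoids_231_def
  proof (intro allI impI notI)
    fix x y z
    assume sub: "subseq [x, y, z] (A @ B)" and less: "z < x" "x < y"
    obtain p q where pq: "[x, y, z] = p @ q" "subseq p A" "subseq q B"
      and "set p \<subseteq> set A" "set q \<subseteq> set B"
      using sub by (rule subseq_append_splitE)
    then have "a < b" if "a \<in> set p" "b \<in> set q" for a b
      using assms that by blast
    then have "p = [] \<or> q = []"
      using pq(1) less by (fastforce simp: Cons_eq_append_conv)
    then have "subseq [x, y, z] A \<or> subseq [x, y, z] B"
      using pq by auto
    then show False
      using less \<open>avoids_231 A\<close> \<open>avoids_231 B\<close> unfolding avoids_231_def by blast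
  qed
qed (auto intro: avoids_231_subseq)

text \<open>For \<open>v\<close> to play the role of 2, a letter above \<open>v\<close> must precede
  one below \<open>v\<close>; but all of \<open>A\<close> comes before \<open>B\<close>.\<close>

lemma avoids_231_Cons_append_iff:
  assumes "\<And>a. a \<in> set A \<Longrightarrow> a < v" and "\<And>b. b \<in> set B \<Longrightarrow> v < b"
  shows "avoids_231 (v # A @ B) \<longleftrightarrow> avoids_231 A \<and> avoids_231 B"
proof -
  have "\<not> v < y" if sub: "subseq [y, z] (A @ B)" and "z < v" for y z
  proof
    assume "v < y"
    obtain p q where pq: "[y, z] = p @ q" "set p \<subseteq> set A" "set q \<subseteq> set B"
      using sub by (rule subseq_append_splitE)
    then show False
      using assms \<open>z < v\<close> \<open>v < y\<close> by (fastforce simp: Cons_eq_append_conv)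
  qed
  moreover have "a < b" if "a \<in> set A" "b \<in> set B" for a b
    using assms that less_trans by blast
  ultimately show ?thesis
    using avoids_231_append_iff[of A B] by (auto simp: avoids_231_Cons_iff)
qed

text \<open>After the first letter above \<open>v\<close> no letter below \<open>v\<close> can
  follow, since the three would form a 231. Hence \<open>A\<close> is the longest initial run of
  letters below \<open>v\<close>.\<close>

lemma avoids_231_Cons_split:
  assumes "avoids_231 (v # w)" and "v \<notin> set w"
  obtains A B where "w = A @ B" "\<forall>a\<in>set A. a < v" "\<forall>b\<in>set B. v < b"
proof
  let ?A = "takeWhile (\<lambda>a. a < v) w" and ?B = "dropWhile (\<lambda>a. a < v) w"
  show w: "w = ?A @ ?B" by simp
  show "\<forall>a\<in>set ?A. a < v"
    using set_takeWhileD by fastforce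
  have "v < b" if b: "b \<in> set ?B" for b
  proof (cases ?B)
    case (Cons y B')
    then have "\<not> y < v"
      by (metis hd_dropWhile list.distinct(1) list.sel(1))
    moreover have "y \<in> set w"
      using Cons by (metis list.set_intros(1) set_dropWhileD)
    ultimately have "v < y"
      using assms(2) by (metis linorder_neqE_nat)
    show ?thesis
    proof (cases "b = y")
      case False
      then have "b \<in> set B'" using b Cons by simp
      then have "subseq [y, b] ?B"
        by (simp add: Cons subseq_singleton_left)
      then have "subseq [y, b] w"
        by (subst w) (rule list_emb_append2)
      then have "\<not> b < v"
        using assms(1) \<open>v < y\<close> by (auto simp: avoids_231_Cons_iff)
      moreover have "b \<noteq> v"
        using b assms(2) set_dropWhileD by fastforce
      ultimately show ?thesis by simp
    qed (use \<open>v < y\<close> in simp)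
  next
    case Nil
    then show ?thesis
      using b by (metis empty_iff list.set(1))
  qed
  then show "\<forall>b\<in>set ?B. v < b" ..
qed

section \<open>Jacobi words\<close>

lemma jacobi_Nil [simp]: "jacobi []"
  by (simp add: jacobi_def)

lemma jacobi_Cons_iff:
  assumes "v \<notin> set w"
  shows "jacobi (v # w) \<longleftrightarrow> even (length (takeWhile (\<lambda>y. v < y) w)) \<and> jacobi w"
proof -
  have "rho (v # w) v = takeWhile (\<lambda>y. v < y) w"
    by (simp add: rho_def)
  moreover have "rho (v # w) x = rho w x" if "x \<in> set w" for x
    using that assms by (auto simp: rho_def)
  ultimately show ?thesis
    by (simp add: jacobi_def)
qed

lemma jacobi_append_iff:
  assumes "A \<noteq> []" and "distinct (A @ B)" and "\<And>a b. a \<in> set A \<Longrightarrow> b \<in> set B \<Longrightarrow> a < b"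
  shows "jacobi (A @ B) \<longleftrightarrow> even (length B) \<and> jacobi A \<and> jacobi B"
  using assms
proof (induction A rule: list_nonempty_induct)
  case (single a)
  then have "length (takeWhile (\<lambda>y. a < y) B) = length B"
    by (metis list.set_intros(1) takeWhile_eq_all_conv)
  then show ?case
    using single by (simp add: jacobi_Cons_iff)
next
  case (cons a A)
  have IH: "jacobi (A @ B) \<longleftrightarrow> even (length B) \<and> jacobi A \<and> jacobi B"
    using cons by simp
  \<comment> \<open>The run after \<open>a\<close> reaches \<open>B\<close> only if all of
    \<open>A\<close> exceeds \<open>a\<close>; it then gains the whole of \<open>B\<close>, an even
    number of letters. Otherwise it stops inside \<open>A\<close>.\<close>
  have "even (length (takeWhile (\<lambda>y. a < y) (A @ B))) \<longleftrightarrow> even (length (takeWhile (\<lambda>y. a < y) A))"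
    if "even (length B)"
  proof (cases "\<forall>x\<in>set A. a < x")
    case True
    then have "takeWhile (\<lambda>y. a < y) (A @ B) = A @ B" "takeWhile (\<lambda>y. a < y) A = A"
      using cons.prems by auto
    then show ?thesis
      using that by (simp only: length_append even_add simp_thms)
  next
    case False
    then show ?thesis by (auto simp: takeWhile_append)
  qed
  then show ?case
    using IH cons.prems by (auto simp: jacobi_Cons_iff)
qed

text \<open>If \<open>A\<close> is nonempty, \<open>v\<close> has an empty run and the last letter
  of \<open>A\<close> forces \<open>B\<close> to have even length; if \<open>A\<close> is empty,
  \<open>v\<close> itself forces it.\<close>

lemma jacobi_Cons_append_iff:
  assumes "distinct (A @ B)" and "\<And>a. a \<in> set A \<Longrightarrow> a < v" and "\<And>b. b \<in> set B \<Longrightarrow> v < b"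
  shows "jacobi (v # A @ B) \<longleftrightarrow> even (length B) \<and> jacobi A \<and> jacobi B"
proof (cases A)
  case Nil
  have "v \<notin> set B"
    using assms(3) by blast
  with Nil assms show ?thesis
    using jacobi_append_iff[of "[v]" B] by (auto simp: jacobi_Cons_iff)
next
  case (Cons a A')
  have "a < b" if "a \<in> set A" "b \<in> set B" for a b
    using assms that less_trans by blast
  then have "jacobi (A @ B) \<longleftrightarrow> even (length B) \<and> jacobi A \<and> jacobi B"
    using assms Cons by (intro jacobi_append_iff) auto
  moreover have "v \<notin> set (A @ B)"
    using assms by fastforce
  moreover have "takeWhile (\<lambda>y. v < y) (A @ B) = []"
    using assms(2)[of a] Cons by simp
  ultimately show ?thesis
    by (simp add: jacobi_Cons_iff)
qed

section \<open>Counting\<close>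

text \<open>The free left end \<open>m\<close> lets the part above the first letter be counted as it
  stands, without relabelling its letters.\<close>

definition jacobi_231_words :: "nat \<Rightarrow> nat \<Rightarrow> nat list set" where
  "jacobi_231_words m n =
    {\<pi> \<in> permutations_of_set {m..<m + n}. jacobi \<pi> \<and> avoids_231 \<pi>}"

lemma mem_jacobi_231_words_iff:
  "\<pi> \<in> jacobi_231_words m n \<longleftrightarrow>
    set \<pi> = {m..<m + n} \<and> distinct \<pi> \<and> jacobi \<pi> \<and> avoids_231 \<pi>"
  by (auto simp: jacobi_231_words_def permutations_of_set_def)

lemma length_jacobi_231_words: "\<pi> \<in> jacobi_231_words m n \<Longrightarrow> length \<pi> = n"
  by (metis mem_jacobi_231_words_iff distinct_card card_atLeastLessThan add_diff_cancel_left')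

lemma finite_jacobi_231_words [simp]: "finite (jacobi_231_words m n)"
  by (simp add: jacobi_231_words_def)

lemma jacobi_231_words_0 [simp]: "jacobi_231_words m 0 = {[]}"
  by (auto simp: mem_jacobi_231_words_iff avoids_231_def)

text \<open>Here \<open>2 * k\<close> is the length of \<open>B\<close>. The first letter has the
  \<open>n - 2 * k\<close> letters of \<open>A\<close> below it, which fixes its value.\<close>

lemma jacobi_231_words_Suc:
  "jacobi_231_words m (Suc n) =
    (\<lambda>(k, A, B). (m + (n - 2 * k)) # A @ B) `
      (SIGMA k:{..n div 2}. jacobi_231_words m (n - 2 * k) \<times>
        jacobi_231_words (Suc (m + (n - 2 * k))) (2 * k))" (is "?L = ?f ` ?S")
proof
  show "?f ` ?S \<subseteq> ?L"
  proof
    fix \<pi> assume "\<pi> \<in> ?f ` ?S"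
    then obtain k A B where "k \<in> {..n div 2}"
      and A: "A \<in> jacobi_231_words m (n - 2 * k)"
      and B: "B \<in> jacobi_231_words (Suc (m + (n - 2 * k))) (2 * k)"
      and \<pi>: "\<pi> = (m + (n - 2 * k)) # A @ B"
      by auto
    then have k: "2 * k \<le> n" by auto
    let ?v = "m + (n - 2 * k)"
    have sets: "set A = {m..<?v}" "set B = {Suc ?v..<m + Suc n}"
      using A B k by (auto simp: mem_jacobi_231_words_iff)
    have less: "\<And>a. a \<in> set A \<Longrightarrow> a < ?v" "\<And>b. b \<in> set B \<Longrightarrow> ?v < b"
      using sets by auto
    have dist: "distinct (A @ B)"
      using A B sets by (auto simp: mem_jacobi_231_words_iff)
    have "jacobi (?v # A @ B)"
      using jacobi_Cons_append_iff[OF dist less] A B length_jacobi_231_words[OF B]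
      by (simp add: mem_jacobi_231_words_iff)
    moreover have "avoids_231 (?v # A @ B)"
      using avoids_231_Cons_append_iff[of A _ B, OF less] A B by (simp add: mem_jacobi_231_words_iff)
    moreover have "set (?v # A @ B) = {m..<m + Suc n}"
      using sets k by auto
    moreover have "distinct (?v # A @ B)"
      using dist sets by auto
    ultimately show "\<pi> \<in> ?L"
      by (simp only: \<pi> mem_jacobi_231_words_iff simp_thms)
  qed
next
  show "?L \<subseteq> ?f ` ?S"
  proof
    fix \<pi> assume \<pi>: "\<pi> \<in> ?L"
    then obtain v w where vw: "\<pi> = v # w"
      using length_jacobi_231_words[OF \<pi>] by (cases \<pi>) auto
    have w: "v \<notin> set w" "distinct w" "avoids_231 (v # w)" "jacobi (v # w)"
      and set: "insert v (set w) = {m..<m + Suc n}"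
      using \<pi> by (simp_all add: mem_jacobi_231_words_iff vw)
    obtain A B where AB: "w = A @ B"
      and "\<forall>a\<in>set A. a < v" "\<forall>b\<in>set B. v < b"
      using avoids_231_Cons_split[OF w(3,1)] by metis
    then have less: "\<And>a. a \<in> set A \<Longrightarrow> a < v" "\<And>b. b \<in> set B \<Longrightarrow> v < b"
      by simp_all
    have v: "v \<in> {m..<m + Suc n}"
      using set by (metis insertI1)
    have dist: "distinct (A @ B)"
      using w AB by simp
    have jac: "even (length B)" "jacobi A" "jacobi B"
      using jacobi_Cons_append_iff[OF dist less] w AB by simp_all
    have av: "avoids_231 A" "avoids_231 B"
      using avoids_231_Cons_append_iff[of A _ B, OF less] w AB by simp_all
    have union: "set A \<union> set B = {m..<m + Suc n} - {v}"
      using set w(1) AB by auto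
    have mem: "x \<in> set A \<longleftrightarrow> x \<in> {m..<m + Suc n} \<and> x < v"
      "x \<in> set B \<longleftrightarrow> x \<in> {m..<m + Suc n} \<and> v < x" for x
      using union less[of x] by (metis DiffD1 DiffI UnE UnI1 UnI2 less_asym less_irrefl singletonD)+
    have sA: "set A = {m..<v}" and sB: "set B = {Suc v..<m + Suc n}"
      using v by (intro set_eqI; simp only: mem; auto)+
    obtain k where k: "length B = 2 * k"
      using jac(1) by blast
    have "length B = m + n - v"
      using dist sB distinct_card[of B] by simp
    then have v_eq: "v = m + (n - 2 * k)" and "2 * k \<le> n"
      using k v by auto
    then have "A \<in> jacobi_231_words m (n - 2 * k)"
      "B \<in> jacobi_231_words (Suc (m + (n - 2 * k))) (2 * k)" "k \<le> n div 2"
      using sA sB dist jac av by (auto simp: mem_jacobi_231_words_iff)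
    then show "\<pi> \<in> ?f ` ?S"
      using vw AB v_eq by (intro image_eqI[of _ _ "(k, A, B)"]) auto
  qed
qed

lemma card_jacobi_231_words_Suc:
  "card (jacobi_231_words m (Suc n)) =
    (\<Sum>k\<le>n div 2. card (jacobi_231_words m (n - 2 * k)) *
      card (jacobi_231_words (Suc (m + (n - 2 * k))) (2 * k)))"
proof -
  let ?f = "\<lambda>(k, A, B). (m + (n - 2 * k)) # A @ B"
  let ?S = "SIGMA k:{..n div 2}. jacobi_231_words m (n - 2 * k) \<times>
    jacobi_231_words (Suc (m + (n - 2 * k))) (2 * k)"
  have "inj_on ?f ?S"
  proof (rule inj_onI)
    fix s s' assume "s \<in> ?S" "s' \<in> ?S" "?f s = ?f s'"
    moreover obtain k A B k' A' B' where s: "s = (k, A, B)" "s' = (k', A', B')"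
      by (cases s, cases s')
    ultimately have "k \<le> n div 2" "k' \<le> n div 2"
      and A: "A \<in> jacobi_231_words m (n - 2 * k)" "A' \<in> jacobi_231_words m (n - 2 * k')"
      and eq: "(m + (n - 2 * k)) # A @ B = (m + (n - 2 * k')) # A' @ B'"
      by auto
    \<comment> \<open>Subtraction is truncated, so the first letter determines \<open>k\<close> only
      thanks to these bounds; \<open>k\<close> then determines where to cut the tail.\<close>
    then have "2 * k \<le> n" "2 * k' \<le> n" "n - 2 * k = n - 2 * k'" by auto
    then have "k = k'" by arith
    moreover from this have "length A = length A'"
      using A by (simp add: length_jacobi_231_words)
    ultimately show "s = s'"
      using eq s by simp
  qed
  then show ?thesis
    unfolding jacobi_231_words_Suc
    by (simp add: card_image card_SigmaI card_cartesian_product)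
qed

text \<open>Exponents 1 and 2 reflect \<open>E\<close> and \<open>O = E^2\<close>. The odd case at
  \<open>n\<close> uses the even case at the same \<open>n\<close>, so the latter is settled
  first.\<close>

lemma card_jacobi_231_words:
  "card (jacobi_231_words m (2 * n)) = ternary_coeff n 1 \<and>
    card (jacobi_231_words m (2 * n + 1)) = ternary_coeff n 2"
proof (induction n arbitrary: m rule: less_induct)
  case (less n)
  have even: "card (jacobi_231_words m (2 * n)) = ternary_coeff n 1" for m
  proof (cases n)
    case (Suc n')
    have "card (jacobi_231_words m (2 * n)) =
      (\<Sum>k\<le>n'. card (jacobi_231_words m (2 * n' + 1 - 2 * k)) *
        card (jacobi_231_words (Suc (m + (2 * n' + 1 - 2 * k))) (2 * k)))"
      using card_jacobi_231_words_Suc[of m "2 * n' + 1"] Suc by simp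
    also have "\<dots> = (\<Sum>k\<le>n'. ternary_coeff (n' - k) 2 * ternary_coeff k 1)"
    proof (rule sum.cong)
      fix k assume "k \<in> {..n'}"
      then have "2 * n' + 1 - 2 * k = 2 * (n' - k) + 1" "k < n" "n' - k < n"
        using Suc by auto
      then show "card (jacobi_231_words m (2 * n' + 1 - 2 * k)) *
          card (jacobi_231_words (Suc (m + (2 * n' + 1 - 2 * k))) (2 * k)) =
        ternary_coeff (n' - k) 2 * ternary_coeff k 1"
        using less.IH by simp
    qed simp
    \<comment> \<open>This is \<open>E = 1 + z * E^3\<close>: as
      \<open>ternary_coeff (Suc n') 0 = 0\<close>, the recursion leaves
      \<open>ternary_coeff n' 3\<close>.\<close>
    also have "\<dots> = ternary_coeff n 1"
      using ternary_coeff_convolution[of n' 2 1] Suc by simp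
    finally show ?thesis .
  qed simp
  have "card (jacobi_231_words m (2 * n + 1)) =
    (\<Sum>k\<le>n. card (jacobi_231_words m (2 * n - 2 * k)) *
      card (jacobi_231_words (Suc (m + (2 * n - 2 * k))) (2 * k)))"
    using card_jacobi_231_words_Suc[of m "2 * n"] by simp
  also have "\<dots> = (\<Sum>k\<le>n. ternary_coeff (n - k) 1 * ternary_coeff k 1)"
  proof (rule sum.cong)
    fix k assume "k \<in> {..n}"
    \<comment> \<open>The end terms \<open>k = 0\<close> and \<open>k = n\<close> involve the index
      \<open>n\<close> itself, which the induction hypothesis does not cover but \<open>even\<close>
      does.\<close>
    have "card (jacobi_231_words m (2 * j)) = ternary_coeff j 1" if "j \<le> n" for m j
      using less.IH even that by (cases "j = n") auto
    from this[of k] this[of "n - k"] \<open>k \<in> {..n}\<close>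
    show "card (jacobi_231_words m (2 * n - 2 * k)) *
        card (jacobi_231_words (Suc (m + (2 * n - 2 * k))) (2 * k)) =
      ternary_coeff (n - k) 1 * ternary_coeff k 1"
      by (simp add: diff_mult_distrib2)
  qed simp
  also have "\<dots> = ternary_coeff n 2"
    using ternary_coeff_convolution[of n 1 1] by (simp add: numeral_2_eq_2)
  finally show ?case
    using even by simp
qed

lemma jacobi_avoiding_count_eq_card: "jacobi_avoiding_count n [2, 3, 1] = card (jacobi_231_words 1 n)"
  by (simp only: jacobi_avoiding_count_def jacobi_231_words_def avoids_231_iff plus_1_eq_Suc
    atLeastLessThanSuc_atLeastAtMost)

theorem theorem5p8:
  fixes n :: nat
  shows "real (jacobi_avoiding_count (2 * n) [2, 3, 1])
           = 1 / real (2 * n + 1) * real ((3 * n) choose n)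
       \<and> real (jacobi_avoiding_count (2 * n + 1) [2, 3, 1])
           = 1 / real (2 * n + 1) * real ((3 * n + 1) choose (n + 1))"
proof -
  define C where "C = (3 * n + 1 choose n)"
  define D where "D = (3 * n + 2 choose n)"
  have C_absorb: "(2 * n + 1) * C = (3 * n + 1) * (3 * n choose n)"
    using binomial_absorb_comp[of "3 * n + 1" n] by (simp add: C_def)
  have "(3 * n + 1) * ternary_coeff n 1 = C"
    using ternary_coeff_closed_form[of 1 n] by (simp add: C_def)
  then have "(3 * n + 1) * ((2 * n + 1) * ternary_coeff n 1) = (3 * n + 1) * (3 * n choose n)"
    by (metis C_absorb mult.left_commute)
  then have even: "(2 * n + 1) * ternary_coeff n 1 = (3 * n choose n)"
    by (subst (asm) mult_cancel1) simp
  have "(3 * n + 2) * ternary_coeff n 2 = 2 * D"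
    using ternary_coeff_closed_form[of 2 n] by (simp add: D_def add.commute)
  then have "(3 * n + 2) * ((n + 1) * ternary_coeff n 2) = (n + 1) * (2 * D)"
    by (metis mult.left_commute)
  \<comment> \<open>Absorption gives \<open>(2 * n + 2) * D = (3 * n + 2) * C\<close>; the factor 2
    comes from the exponent.\<close>
  also have "\<dots> = (3 * n + 2) * C"
    using binomial_absorb_comp[of "3 * n + 2" n] by (simp add: C_def D_def algebra_simps)
  finally have C_eq: "(n + 1) * ternary_coeff n 2 = C"
    by (subst (asm) mult_cancel1) simp
  \<comment> \<open>Both sides equal \<open>(3 * n + 1) * (3 * n choose n)\<close>.\<close>
  have "(n + 1) * (3 * n + 1 choose (n + 1)) = (2 * n + 1) * C"
    using binomial_absorption[of n "3 * n + 1"] C_absorb by simp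
  then have "(n + 1) * ((2 * n + 1) * ternary_coeff n 2) = (n + 1) * (3 * n + 1 choose (n + 1))"
    by (metis C_eq mult.left_commute)
  then have odd: "(2 * n + 1) * ternary_coeff n 2 = (3 * n + 1 choose (n + 1))"
    by (subst (asm) mult_cancel1) simp
  have "real (jacobi_avoiding_count (2 * n) [2, 3, 1]) * real (2 * n + 1) = real (3 * n choose n)"
    "real (jacobi_avoiding_count (2 * n + 1) [2, 3, 1]) * real (2 * n + 1)
      = real (3 * n + 1 choose (n + 1))"
    using card_jacobi_231_words[of 1 n]
    unfolding jacobi_avoiding_count_eq_card even[symmetric] odd[symmetric]
    by (simp_all only: of_nat_mult mult.commute)
  then show ?thesis
    by (simp add: field_simps)
qed

end
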